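(* Let $\mathcal N$ be a vertex-weighted simple-crossing oriented network on a compact connected oriented surface $S$ with underlying unweighted network $N$ and vertex weights $x_v$ in a field containing a field $K$. Let $W_N$ be the associated $\mathbb Z$-module, $k$ its rank, and $w_1,\dots,w_k$ a $\mathbb Z$-basis of $W_N$. For $\tau=(\tau_1,\dots,\tau_k)\in T=(K^* )^k$ let $\tau\cdot\mathcal N$ be the network with the same underlying network and vertex weights $$y_v=\Big(\prod_{i=1}^k \tau_i^{\langle e_v,w_i\rangle}\Big)x_v .$$ Then this defines an action of the torus $T$ (on weighted networks with underlying network $N$), and it preserves all boundary measurements and all cycle measurements of $\mathcal N$.
   Context: An oriented network on $S$ (compact connected oriented, possibly with boundary) consists of finitely many vertices in $S$ (possibly on $\partial S$) and finitely many directed edges whose endpoints are vertices and whose interiors meet neither the boundary nor other edges; closed oriented loops without endpoints are allowed. Boundary vertices have degree at most one. Simple-crossing: each non-boundary vertex has in-degree 2, out-degree 2 and adjacent incoming edges. Interior vertices $v$ carry weights $x_v$. At an interior vertex let $e_1,e_2,f_1,f_2$ be the edges in counterclockwise order with $e_i$ incoming, $f_i$ outgoing; $e_1,f_1$ is the highway, $e_2,f_2$ the underway. A highway path (highway cycle) is a directed walk (closed directed walk without distinguished start) that never enters a vertex via $e_2$ and leaves it via $f_2$. Its weight is the product, with multiplicity, of $x_v$ over passages entering via $e_1$ and leaving via $f_1$. The boundary measurement for boundary vertices $u,v$ and a homology class of paths from $u$ to $v$ (two such paths are homologous if one followed by the reverse of the other is zero in $H_1(S,\mathbb Z)$) is the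 sum of weights of all highway paths from $u$ to $v$ in this class. The cycle measurement for a class in $H_1(S,\mathbb Z)$ is $\sum_q \mathrm{wt}(q)/\mathrm{mult}(q)$ over highway cycles $q$ in that class, $\mathrm{mult}(q)$ being the largest $k$ such that $q$ is a $k$-fold repetition of a cycle; cycle measurements for the trivial class are not considered. A snake path in $N$ is a path starting and ending on the boundary that turns at every interior vertex (i.e. passes $e_1\to f_2$ or $e_2\to f_1$); a snake cycle is a cycle that turns at every interior vertex. Every edge belongs to a unique snake path or snake cycle. Define a directed graph $H_N$: its vertices are the snake paths and snake cycles of $N$; for each interior vertex $v$ of $N$ there is a directed edge $e_v$ of $H_N$ from $p$ to $q$, where $p$ is the snake path or cycle containing the incoming highway edge $e_1$ at $v$ and $q$ is the one containing the outgoing highway edge $f_1$ at $v$ (possibly $p=q$). Let $V_N$ be the free $\mathbb Z$-module on the edges of $H_N$, with the inner product $\langle\cdot,\cdot\rangle$ making the edges orthonormal. Vertices of $H_N$ that are snake paths are called terminal. Let $U$ be the set of all closed (directed) walks in $H_N$ together with all (directed) walks in $H_N$ from terminal vertices to terminal vertices, and for $u\in U$ let $a_u\in V_N$ be the sum, with multiplicity, of the edges of $u$. Finally $$W_N=\{w\in V_N : \langle w,a_u\rangle=0\ \text{for all } u\in U\}.$$ *)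

theory Defs
  imports
    "HOL-Homology.Homology"
    "HOL-Complex_Analysis.Complex_Analysis"
    "HOL-Algebra.Algebra"
    "Graph_Theory.Arc_Walk"
begin

section \<open>Oriented surfaces\<close>

type_synonym 'a chart = "'a set \<times> ('a \<Rightarrow> complex)"

definition half_plane_chart :: "'a topology \<Rightarrow> 'a chart \<Rightarrow> bool" where
  "half_plane_chart S = (\<lambda>(U, \<phi>). openin S U \<and>
     (\<exists>V. openin (top_of_set {z. 0 \<le> Im z}) V \<and>
          homeomorphic_map (subtopology S U) (top_of_set V) \<phi>))"

text \<open>The change of coordinates sends a small counterclockwise circle around \<open>z\<close> to a curve
  that winds once counterclockwise around the image of \<open>z\<close> (rather than \<open>-1\<close> times).\<close>

definition orientation_compatible :: "'a chart \<Rightarrow> 'a chart \<Rightarrow> bool" where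
  "orientation_compatible = (\<lambda>(U, \<phi>) (U', \<phi>').
     \<forall>z r. 0 < r \<and> cball z r \<subseteq> \<phi> ` (U \<inter> U') \<longrightarrow>
       winding_number (\<phi>' \<circ> inv_into U \<phi> \<circ> circlepath z r) (\<phi>' (inv_into U \<phi> z)) = 1)"

text \<open>A compact connected surface, possibly with boundary, oriented by an atlas \<open>A\<close>.\<close>

definition oriented_surface :: "'a topology \<Rightarrow> 'a chart set \<Rightarrow> bool" where
  "oriented_surface S A \<longleftrightarrow>
     topspace S \<noteq> {} \<and> Hausdorff_space S \<and> compact_space S \<and> connected_space S \<and>
     (\<forall>C\<in>A. half_plane_chart S C) \<and> topspace S = \<Union> (fst ` A) \<and>
     (\<forall>C\<in>A. \<forall>C'\<in>A. orientation_compatible C C')"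

text \<open>By invariance of the boundary it does not matter which chart around \<open>x\<close> is used.\<close>

definition surface_boundary :: "'a topology \<Rightarrow> 'a set" where
  "surface_boundary S = {x. \<exists>U \<phi>. half_plane_chart S (U, \<phi>) \<and> x \<in> U \<and> Im (\<phi> x) = 0}"


section \<open>Paths and their homology classes\<close>

definition paths_from_to :: "'a topology \<Rightarrow> 'a \<Rightarrow> 'a \<Rightarrow> (real \<Rightarrow> 'a) set" where
  "paths_from_to S u v = {g. pathin S g \<and> g 0 = u \<and> g 1 = v}"

text \<open>These are \<open>reversepath\<close> and \<open>joinpaths\<close>, whose library versions require the points to
  form a type of class \<open>topological_space\<close>.\<close>

definition reverse_path :: "(real \<Rightarrow> 'a) \<Rightarrow> real \<Rightarrow> 'a" where
  "reverse_path g = (\<lambda>t. g (1 - t))"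

definition join_paths :: "(real \<Rightarrow> 'a) \<Rightarrow> (real \<Rightarrow> 'a) \<Rightarrow> real \<Rightarrow> 'a" where
  "join_paths g h = (\<lambda>t. if t \<le> 1/2 then g (2 * t) else h (2 * t - 1))"

text \<open>The class in \<open>homology_group 1 S\<close> of a closed path, viewed as a singular 1-simplex.\<close>

definition loop_class :: "'a topology \<Rightarrow> (real \<Rightarrow> 'a) \<Rightarrow> 'a chain set" where
  "loop_class S g = homologous_rel_set 1 S {} (frag_of (\<lambda>x\<in>standard_simplex 1. g (x 1)))"

definition homologous_paths ::
    "'a topology \<Rightarrow> 'a \<Rightarrow> 'a \<Rightarrow> ((real \<Rightarrow> 'a) \<times> (real \<Rightarrow> 'a)) set" where
  "homologous_paths S u v =
     {(g, h). g \<in> paths_from_to S u v \<and> h \<in> paths_from_to S u v \<and>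
              loop_class S (join_paths g (reverse_path h)) = \<one>\<^bsub>homology_group 1 S\<^esub>}"

definition path_classes :: "'a topology \<Rightarrow> 'a \<Rightarrow> 'a \<Rightarrow> (real \<Rightarrow> 'a) set set" where
  "path_classes S u v = paths_from_to S u v // homologous_paths S u v"


section \<open>Simple-crossing oriented networks\<close>

text \<open>Vertices are points of the surface; an edge, or a closed loop without endpoints, \<open>e\<close> is
  the curve \<open>curve N e\<close> on \<open>[0, 1]\<close>. At an interior vertex \<open>v\<close>, \<open>high_in N v\<close>,
  \<open>under_in N v\<close>, \<open>high_out N v\<close>, \<open>under_out N v\<close> are the edges \<open>e\<^sub>1, e\<^sub>2, f\<^sub>1, f\<^sub>2\<close>.\<close>

record ('a, 'e) network =
  vertices :: "'a set"
  edges :: "'e set"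
  loops :: "'e set"
  curve :: "'e \<Rightarrow> real \<Rightarrow> 'a"
  high_in :: "'a \<Rightarrow> 'e"
  under_in :: "'a \<Rightarrow> 'e"
  high_out :: "'a \<Rightarrow> 'e"
  under_out :: "'a \<Rightarrow> 'e"

definition net_graph :: "('a, 'e) network \<Rightarrow> ('a, 'e) pre_digraph" where
  "net_graph N = \<lparr>verts = vertices N, arcs = edges N,
                  tail = (\<lambda>e. curve N e 0), head = (\<lambda>e. curve N e 1)\<rparr>"

abbreviation source :: "('a, 'e) network \<Rightarrow> 'e \<Rightarrow> 'a" where
  "source N \<equiv> tail (net_graph N)"

abbreviation target :: "('a, 'e) network \<Rightarrow> 'e \<Rightarrow> 'a" where
  "target N \<equiv> head (net_graph N)"

definition interior_vertices :: "'a topology \<Rightarrow> ('a, 'e) network \<Rightarrow> 'a set" where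
  "interior_vertices S N = vertices N - surface_boundary S"

definition boundary_vertices :: "'a topology \<Rightarrow> ('a, 'e) network \<Rightarrow> 'a set" where
  "boundary_vertices S N = vertices N \<inter> surface_boundary S"

definition oriented_network :: "'a topology \<Rightarrow> ('a, 'e) network \<Rightarrow> bool" where
  "oriented_network S N \<longleftrightarrow>
     finite (vertices N) \<and> finite (edges N) \<and> finite (loops N) \<and>
     vertices N \<subseteq> topspace S \<and> edges N \<inter> loops N = {} \<and>
     (\<forall>e\<in>edges N. pathin S (curve N e) \<and> source N e \<in> vertices N \<and> target N e \<in> vertices N \<and>
        inj_on (curve N e) {0<..<1} \<and>
        curve N e ` {0<..<1} \<inter> (vertices N \<union> surface_boundary S) = {}) \<and>
     (\<forall>l\<in>loops N. pathin S (curve N l) \<and> curve N l 0 = curve N l 1 \<and>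
        inj_on (curve N l) {0..<1} \<and>
        curve N l ` {0..1} \<inter> (vertices N \<union> surface_boundary S) = {}) \<and>
     (\<forall>e\<in>edges N \<union> loops N. \<forall>e'\<in>edges N \<union> loops N. e \<noteq> e' \<longrightarrow>
        curve N e ` {0<..<1} \<inter> curve N e' ` {0..1} = {}) \<and>
     (\<forall>v\<in>boundary_vertices S N.
        card {e \<in> edges N. source N e = v} + card {e \<in> edges N. target N e = v} \<le> 1)"

definition open_ray :: "complex \<Rightarrow> complex set" where
  "open_ray d = {of_real r * d | r::real. 0 < r}"

text \<open>Counterclockwise order \<open>e\<^sub>1, e\<^sub>2, f\<^sub>1, f\<^sub>2\<close> around \<open>v\<close>: some positively oriented disc
  coordinate centred at \<open>v\<close> makes the four edge ends start along the rays through
  \<open>1, \<i>, -1, -\<i>\<close>. Edge ends rather than edges are compared, since an edge from \<open>v\<close> to \<open>v\<close>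
  occurs twice.\<close>

definition ccw_crossing :: "'a topology \<Rightarrow> 'a chart set \<Rightarrow> ('a, 'e) network \<Rightarrow> 'a \<Rightarrow> bool" where
  "ccw_crossing S A N v \<longleftrightarrow>
     (\<exists>U \<psi> \<epsilon>. openin S U \<and> v \<in> U \<and>
        homeomorphic_map (subtopology S U) (top_of_set (ball 0 1)) \<psi> \<and> \<psi> v = 0 \<and>
        (\<forall>C\<in>A. orientation_compatible (U, \<psi>) C) \<and>
        0 < (\<epsilon>::real) \<and> \<epsilon> < 1 \<and>
        (\<forall>t. 0 < t \<and> t < \<epsilon> \<longrightarrow>
           {curve N (high_in N v) (1 - t), curve N (under_in N v) (1 - t),
            curve N (high_out N v) t, curve N (under_out N v) t} \<subseteq> U \<and>
           \<psi> (curve N (high_in N v) (1 - t)) \<in> open_ray 1 \<and>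
           \<psi> (curve N (under_in N v) (1 - t)) \<in> open_ray \<i> \<and>
           \<psi> (curve N (high_out N v) t) \<in> open_ray (-1) \<and>
           \<psi> (curve N (under_out N v) t) \<in> open_ray (-\<i>)))"

definition simple_crossing_network ::
    "'a topology \<Rightarrow> 'a chart set \<Rightarrow> ('a, 'e) network \<Rightarrow> bool" where
  "simple_crossing_network S A N \<longleftrightarrow> oriented_network S N \<and>
     (\<forall>v\<in>interior_vertices S N.
        {e \<in> edges N. target N e = v} = {high_in N v, under_in N v} \<and>
        high_in N v \<noteq> under_in N v \<and>
        {e \<in> edges N. source N e = v} = {high_out N v, under_out N v} \<and>
        high_out N v \<noteq> under_out N v \<and>
        ccw_crossing S A N v)"


section \<open>Highway paths, highway cycles and measurements\<close>

text \<open>Walks are lists of edges; a closed walk without distinguished start is the set of all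
  rotations of such a list. A passage is a pair of consecutive edges.\<close>

definition passages :: "'e list \<Rightarrow> ('e \<times> 'e) list" where
  "passages p = zip p (tl p)"

definition cyclic_passages :: "'e list \<Rightarrow> ('e \<times> 'e) list" where
  "cyclic_passages p = zip p (rotate1 p)"

definition rotations :: "'e list \<Rightarrow> 'e list set" where
  "rotations p = {rotate n p | n. True}"

definition high_passage :: "'a topology \<Rightarrow> ('a, 'e) network \<Rightarrow> 'e \<times> 'e \<Rightarrow> bool" where
  "high_passage S N = (\<lambda>(e, e'). let v = target N e in
     v \<in> interior_vertices S N \<and> e = high_in N v \<and> e' = high_out N v)"

definition under_passage :: "'a topology \<Rightarrow> ('a, 'e) network \<Rightarrow> 'e \<times> 'e \<Rightarrow> bool" where
  "under_passage S N = (\<lambda>(e, e'). let v = target N e in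
     v \<in> interior_vertices S N \<and> e = under_in N v \<and> e' = under_out N v)"

definition turn :: "'a topology \<Rightarrow> ('a, 'e) network \<Rightarrow> 'e \<times> 'e \<Rightarrow> bool" where
  "turn S N = (\<lambda>(e, e'). let v = target N e in
     v \<in> interior_vertices S N \<and>
     (e = high_in N v \<and> e' = under_out N v \<or> e = under_in N v \<and> e' = high_out N v))"

definition highway_path ::
    "'a topology \<Rightarrow> ('a, 'e) network \<Rightarrow> 'a \<Rightarrow> 'e list \<Rightarrow> 'a \<Rightarrow> bool" where
  "highway_path S N u p v \<longleftrightarrow> pre_digraph.awalk (net_graph N) u p v \<and>
     (\<forall>a\<in>set (passages p). \<not> under_passage S N a)"

text \<open>A loop without endpoints may be traversed any positive number of times.\<close>

definition closed_walks :: "('a, 'e) network \<Rightarrow> 'e list set" where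
  "closed_walks N = {p. p \<noteq> [] \<and> (\<exists>u. pre_digraph.awalk (net_graph N) u p u)} \<union>
     {replicate m l | m l. 1 \<le> m \<and> l \<in> loops N}"

definition highway_cycles :: "'a topology \<Rightarrow> ('a, 'e) network \<Rightarrow> 'e list set set" where
  "highway_cycles S N = {rotations p | p. p \<in> closed_walks N \<and>
     (\<forall>a\<in>set (cyclic_passages p). \<not> under_passage S N a)}"

definition passage_weight ::
    "'a topology \<Rightarrow> ('a, 'e) network \<Rightarrow> ('a \<Rightarrow> 'k::field) \<Rightarrow> ('e \<times> 'e) list \<Rightarrow> 'k" where
  "passage_weight S N x ps =
     prod_list (map (\<lambda>a. if high_passage S N a then x (target N (fst a)) else 1) ps)"

definition path_weight ::
    "'a topology \<Rightarrow> ('a, 'e) network \<Rightarrow> ('a \<Rightarrow> 'k::field) \<Rightarrow> 'e list \<Rightarrow> 'k" where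
  "path_weight S N x p = passage_weight S N x (passages p)"

definition cycle_weight ::
    "'a topology \<Rightarrow> ('a, 'e) network \<Rightarrow> ('a \<Rightarrow> 'k::field) \<Rightarrow> 'e list set \<Rightarrow> 'k" where
  "cycle_weight S N x q = passage_weight S N x (cyclic_passages (SOME p. p \<in> q))"

definition cycle_mult :: "'e list set \<Rightarrow> nat" where
  "cycle_mult q = Max {k. \<exists>r. concat (replicate k r) \<in> q}"

fun walk_path :: "('a, 'e) network \<Rightarrow> 'a \<Rightarrow> 'e list \<Rightarrow> real \<Rightarrow> 'a" where
  "walk_path N u [] = (\<lambda>_. u)"
| "walk_path N u [e] = curve N e"
| "walk_path N u (e # e' # es) = join_paths (curve N e) (walk_path N (target N e) (e' # es))"

definition cycle_class :: "'a topology \<Rightarrow> ('a, 'e) network \<Rightarrow> 'e list set \<Rightarrow> 'a chain set" where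
  "cycle_class S N q = (let p = (SOME p. p \<in> q) in loop_class S (walk_path N (source N (hd p)) p))"

text \<open>The sums below may be infinite. They are unconditional sums with respect to a topology
  \<open>T\<close> on the field, undefined (\<open>None\<close>) if they do not converge to a unique value. For the
  discrete topology only sums that are eventually constant converge; for a formal power (Laurent)
  series field one takes its usual topology.\<close>

definition field_sum :: "'k::field topology \<Rightarrow> ('i \<Rightarrow> 'k) \<Rightarrow> 'i set \<Rightarrow> 'k option" where
  "field_sum T f I = (let P = (\<lambda>s. limitin T (sum f) s (finite_subsets_at_top I)) in
     if \<exists>!s. P s then Some (THE s. P s) else None)"

definition boundary_measurement ::
    "'k::field topology \<Rightarrow> 'a topology \<Rightarrow> ('a, 'e) network \<Rightarrow> ('a \<Rightarrow> 'k) \<Rightarrow>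
     'a \<Rightarrow> 'a \<Rightarrow> (real \<Rightarrow> 'a) set \<Rightarrow> 'k option" where
  "boundary_measurement T S N x u v c =
     field_sum T (path_weight S N x) {p. highway_path S N u p v \<and> walk_path N u p \<in> c}"

text \<open>Also undefined if one of the multiplicities vanishes in the field, instead of using
  \<open>y / 0 = 0\<close>.\<close>

definition cycle_measurement ::
    "'k::field topology \<Rightarrow> 'a topology \<Rightarrow> ('a, 'e) network \<Rightarrow> ('a \<Rightarrow> 'k) \<Rightarrow>
     'a chain set \<Rightarrow> 'k option" where
  "cycle_measurement T S N x c = (let Q = {q \<in> highway_cycles S N. cycle_class S N q = c} in
     if \<exists>q\<in>Q. (of_nat (cycle_mult q) :: 'k) = 0 then None
     else field_sum T (\<lambda>q. cycle_weight S N x q / of_nat (cycle_mult q)) Q)"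


section \<open>Snakes and the module \<open>W\<close>\<close>

datatype 'e snake = SnakePath "'e list" | SnakeCycle "'e list set"

fun snake_edges :: "'e snake \<Rightarrow> 'e set" where
  "snake_edges (SnakePath p) = set p"
| "snake_edges (SnakeCycle q) = \<Union> (set ` q)"

text \<open>A snake cycle is traversed once, i.e. its edges are distinct; otherwise an edge would lie
  on infinitely many of them. A loop without endpoints is a snake cycle by itself.\<close>

definition snakes :: "'a topology \<Rightarrow> ('a, 'e) network \<Rightarrow> 'e snake set" where
  "snakes S N =
     {SnakePath p | p u v. p \<noteq> [] \<and> u \<in> boundary_vertices S N \<and> v \<in> boundary_vertices S N \<and>
        pre_digraph.awalk (net_graph N) u p v \<and> (\<forall>a\<in>set (passages p). turn S N a)} \<union>
     {SnakeCycle (rotations p) | p u. p \<noteq> [] \<and> distinct p \<and>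
        pre_digraph.awalk (net_graph N) u p u \<and> (\<forall>a\<in>set (cyclic_passages p). turn S N a)} \<union>
     {SnakeCycle {[l]} | l. l \<in> loops N}"

definition snake_of :: "'a topology \<Rightarrow> ('a, 'e) network \<Rightarrow> 'e \<Rightarrow> 'e snake" where
  "snake_of S N e = (THE s. s \<in> snakes S N \<and> e \<in> snake_edges s)"

text \<open>The graph \<open>H\<close>; its arc \<open>e\<^sub>v\<close> is represented by the interior vertex \<open>v\<close> itself.\<close>

definition snake_graph :: "'a topology \<Rightarrow> ('a, 'e) network \<Rightarrow> ('e snake, 'a) pre_digraph" where
  "snake_graph S N = \<lparr>verts = snakes S N, arcs = interior_vertices S N,
                      tail = (\<lambda>v. snake_of S N (high_in N v)),
                      head = (\<lambda>v. snake_of S N (high_out N v))\<rparr>"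

definition terminals :: "'a topology \<Rightarrow> ('a, 'e) network \<Rightarrow> 'e snake set" where
  "terminals S N = snakes S N \<inter> range SnakePath"

definition test_walks :: "'a topology \<Rightarrow> ('a, 'e) network \<Rightarrow> 'a list set" where
  "test_walks S N =
     {p. \<exists>s. pre_digraph.awalk (snake_graph S N) s p s} \<union>
     {p. \<exists>s\<in>terminals S N. \<exists>t\<in>terminals S N. pre_digraph.awalk (snake_graph S N) s p t}"

definition arc_module :: "'a topology \<Rightarrow> ('a, 'e) network \<Rightarrow> ('a \<Rightarrow> int) set" where
  "arc_module S N = {w. \<forall>v. v \<notin> interior_vertices S N \<longrightarrow> w v = 0}"

definition arc_inner ::
    "'a topology \<Rightarrow> ('a, 'e) network \<Rightarrow> ('a \<Rightarrow> int) \<Rightarrow> ('a \<Rightarrow> int) \<Rightarrow> int" where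
  "arc_inner S N w z = (\<Sum>v\<in>interior_vertices S N. w v * z v)"

definition arc_vec :: "'a \<Rightarrow> 'a \<Rightarrow> int" where
  "arc_vec v = (\<lambda>u. if u = v then 1 else 0)"

definition walk_vec :: "'a list \<Rightarrow> 'a \<Rightarrow> int" where
  "walk_vec p = (\<lambda>u. \<Sum>v\<leftarrow>p. arc_vec v u)"

definition W_module :: "'a topology \<Rightarrow> ('a, 'e) network \<Rightarrow> ('a \<Rightarrow> int) set" where
  "W_module S N = {w \<in> arc_module S N. \<forall>p\<in>test_walks S N. arc_inner S N w (walk_vec p) = 0}"

text \<open>\<open>w 0, \<dots>, w (k - 1)\<close> is a basis of the free abelian group \<open>W\<close>, which thus has rank \<open>k\<close>.\<close>

definition Z_basis :: "('a \<Rightarrow> int) set \<Rightarrow> nat \<Rightarrow> (nat \<Rightarrow> 'a \<Rightarrow> int) \<Rightarrow> bool" where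
  "Z_basis W k w \<longleftrightarrow> (\<forall>i<k. w i \<in> W) \<and>
     (\<forall>z\<in>W. \<exists>!c. c \<in> {..<k} \<rightarrow>\<^sub>E (UNIV::int set) \<and> z = (\<lambda>v. \<Sum>i<k. c i * w i v))"


section \<open>The torus action\<close>

definition is_subfield :: "'k::field set \<Rightarrow> bool" where
  "is_subfield K \<longleftrightarrow> 0 \<in> K \<and> 1 \<in> K \<and>
     (\<forall>a\<in>K. \<forall>b\<in>K. a - b \<in> K \<and> a * b \<in> K) \<and> (\<forall>a\<in>K. inverse a \<in> K)"

definition units_group :: "'k::field set \<Rightarrow> 'k monoid" where
  "units_group K = \<lparr>carrier = K - {0}, monoid.mult = (*), one = 1\<rparr>"

definition torus :: "'k::field set \<Rightarrow> nat \<Rightarrow> (nat \<Rightarrow> 'k) monoid" where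
  "torus K k = product_group {..<k} (\<lambda>_. units_group K)"

definition weightings :: "'a topology \<Rightarrow> ('a, 'e) network \<Rightarrow> ('a \<Rightarrow> 'k::field) set" where
  "weightings S N = interior_vertices S N \<rightarrow>\<^sub>E UNIV"

definition torus_act ::
    "'a topology \<Rightarrow> ('a, 'e) network \<Rightarrow> nat \<Rightarrow> (nat \<Rightarrow> 'a \<Rightarrow> int) \<Rightarrow> (nat \<Rightarrow> 'k::field) \<Rightarrow>
     ('a \<Rightarrow> 'k) \<Rightarrow> 'a \<Rightarrow> 'k" where
  "torus_act S N k w \<tau> x =
     (\<lambda>v\<in>interior_vertices S N. (\<Prod>i<k. \<tau> i powi arc_inner S N (arc_vec v) (w i)) * x v)"

end

theory Submission
  imports Defs
begin

text \<open>Acting by \<open>\<tau>\<close> multiplies the weight of a highway walk by the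
  product over \<open>i\<close> of the powers of \<open>\<tau>\<^sub>i\<close> with exponents \<open>\<Sum>\<^sub>v w\<^sub>i(v)\<close>, where \<open>v\<close> runs, with multiplicity, over the
  vertices that the walk crosses straight along the highway
  (\<open>torus_act_passage_weight_factor\<close>). So it suffices that this list of vertices is a test
  walk in the graph of snakes, for then every \<open>w\<^sub>i\<close> pairs to zero with it.

  This holds because a highway walk only ever turns or goes straight on the highway
  (\<open>highway_passage_cases\<close>). While it turns it stays on one snake (\<open>snake_of_turn\<close>); when it
  goes straight at \<open>v\<close> it passes from the snake of the incoming to the snake of the outgoing
  highway edge, which is precisely the arc \<open>e\<^sub>v\<close>. Hence the vertices crossed straight form a walk
  from the snake of the first edge to the snake of the last one (\<open>highway_walk_snake_walk\<close>).
  For a highway cycle this walk is closed. A highway path between boundary vertices begins and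
  ends with edges incident to the boundary; their snakes cannot be cycles and so are terminal
  (\<open>snake_of_terminal\<close>). Thus each path and each cycle keeps its own weight, and the
  measurements, being sums over index sets that do not involve the weights, agree term by term,
  whether or not they converge.

  What needs work is that every edge lies on exactly one snake, since the snake of an edge is
  defined by a definite description. Turning is a partial injection of the finite set of edges,
  undefined exactly at edges that end on the boundary, and with exactly the edges that start on
  the boundary outside its range. The orbits of such a map are paths between the two kinds of
  exceptional edges, and cycles (\<open>ex_snake\<close>, \<open>snake_unique\<close>).

  That the torus acts at all is the multiplicativity of integer powers in the base.\<close>


section \<open>Chains of a partial injection\<close>

lemma passages_Cons: "passages (a # b # p) = (a, b) # passages (b # p)"
  by (simp add: passages_def)

lemma successively_iff_passages:
  "successively (\<lambda>a b. Q (a, b)) p \<longleftrightarrow> (\<forall>a\<in>set (passages p). Q a)"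
  by (induction p rule: induct_list012) (auto simp: passages_def)

text \<open>Repeating the first edge at the end makes a cyclic walk an ordinary one, so that cycles
  and paths can share the argument about passages.\<close>

lemma cyclic_passages_eq_passages:
  assumes "p \<noteq> []"
  shows "cyclic_passages p = passages (p @ [hd p])"
proof -
  obtain a q where p: "p = a # q" using assms by (cases p) auto
  have "zip (a # q) (q @ [a]) = zip ((a # q) @ [a]) (q @ [a])"
    by (subst zip_append1) simp
  then show ?thesis by (simp add: cyclic_passages_def passages_def p)
qed

lemma rotate_cyclic_passages: "cyclic_passages (rotate n p) = rotate n (cyclic_passages p)"
proof (induction n)
  case (Suc n)
  have "zip (rotate1 a) (rotate1 b) = rotate1 (zip a b)" if "length a = length b" for a b :: "'a list"
    using that by (cases a; cases b) auto
  then show ?case using Suc by (simp add: cyclic_passages_def)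
qed simp

lemma rotations_rotate: "rotations (rotate n p) = rotations p"
proof -
  have "rotate m p \<in> rotations (rotate n p)" for m
  proof (cases "p = []")
    case True
    then show ?thesis by (simp add: rotations_def)
  next
    case False
    \<comment> \<open>rotating back by \<open>n\<close> is rotating forwards by \<open>length p * n - n\<close>\<close>
    have "(m + (length p * n - n)) + n = m + length p * n"
      using False by (cases p) auto
    then have "rotate (m + (length p * n - n)) (rotate n p) = rotate m p"
      by (metis mod_mult_self2 rotate_conv_mod rotate_rotate)
    then show ?thesis unfolding rotations_def by (metis (mono_tags, lifting) mem_Collect_eq)
  qed
  then show ?thesis by (auto simp: rotations_def rotate_rotate)
qed

text \<open>A partial function determines how a chain continues, so that two chains with the same
  start can differ only in their length.\<close>

lemma chains_of_function_comparable:
  assumes "\<And>a b c. r a b \<Longrightarrow> r a c \<Longrightarrow> b = c"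
    and "successively r (a # p)" and "successively r (a # q)"
  shows "(\<exists>z. q = p @ z) \<or> (\<exists>z. p = q @ z)"
  using assms(2,3)
proof (induction p arbitrary: a q)
  case (Cons b p)
  show ?case
  proof (cases q)
    case (Cons c q')
    then have "c = b" using Cons.prems assms(1) by auto
    then show ?thesis using Cons.IH[of b q'] Cons.prems Cons by auto
  qed simp
qed simp

lemma terminated_chain_unique:
  assumes "\<And>a b c. r a b \<Longrightarrow> r a c \<Longrightarrow> b = c"
    and "successively r (a # p)" "successively r (a # q)"
    and "\<And>b. \<not> r (last (a # p)) b" "\<And>b. \<not> r (last (a # q)) b"
  shows "p = q"
proof -
  have ext: "z = []" if "successively r (a # p @ z)" and "\<And>b. \<not> r (last (a # p)) b" for p z
  proof (rule ccontr)
    assume "z \<noteq> []"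
    have "successively r ((a # p) @ z)" using that by simp
    then show False using \<open>z \<noteq> []\<close> that(2) by (simp only: successively_append_iff) auto
  qed
  show ?thesis
    using chains_of_function_comparable[of r a p q] assms ext[of p] ext[of q] by force
qed

lemma cyclic_chain_unique:
  assumes "\<And>a b c. r a b \<Longrightarrow> r a c \<Longrightarrow> b = c"
    and "successively r (a # p @ [a])" "successively r (a # q @ [a])"
    and "a \<notin> set p" "a \<notin> set q"
  shows "p = q"
proof -
  have *: "p = q" if "q @ [a] = (p @ [a]) @ z" "a \<notin> set p" "a \<notin> set q" for p q z
    using that by (cases z rule: rev_cases) auto
  show ?thesis
    using chains_of_function_comparable[of r a "p @ [a]" "q @ [a]"] assms
      *[of q p] *[of p q] by metis
qed

lemma chain_in_closed_set:
  assumes "successively r (a # p)" "a \<in> Y" "\<And>b c. b \<in> Y \<Longrightarrow> r b c \<Longrightarrow> c \<in> Y"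
  shows "set (a # p) \<subseteq> Y"
  using assms(1,2)
proof (induction p arbitrary: a)
  case (Cons b p)
  then show ?case using assms(3)[of a b] by auto
qed auto

lemma rotate_to_head:
  assumes "a \<in> set p"
  obtains n q where "rotate n p = a # q"
proof -
  obtain u v where "p = u @ a # v" using assms by (meson split_list)
  then have "rotate (length u) p = a # v @ u" by (simp add: rotate_append)
  then show ?thesis by (rule that)
qed

text \<open>A longest chain without repetition through \<open>a\<close> cannot be extended at either end. A
  successor of its last element would therefore lie on the chain, and by injectivity can only be
  its first element, as every other element already has its predecessor there; dually for a
  predecessor of the first element. So the chain either is stuck at both ends or closes up.\<close>

lemma maximal_chain:
  assumes fin: "finite E" and a: "a \<in> E"
    and r: "\<And>x y. r x y \<Longrightarrow> x \<in> E \<and> y \<in> E"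
    and fwd: "\<And>x y z. r x y \<Longrightarrow> r x z \<Longrightarrow> y = z"
    and bwd: "\<And>x y z. r x z \<Longrightarrow> r y z \<Longrightarrow> x = y"
  obtains p where "p \<noteq> []" "a \<in> set p" "set p \<subseteq> E" "distinct p" "successively r p"
    "(\<forall>b. \<not> r (last p) b) \<and> (\<forall>b. \<not> r b (hd p)) \<or> r (last p) (hd p)"
proof -
  \<comment> \<open>the chains among which a longest one is taken; their length is at most the size of \<open>E\<close>\<close>
  define C where "C p \<longleftrightarrow> a \<in> set p \<and> set p \<subseteq> E \<and> distinct p \<and> successively r p" for p
  have "C [a]" using a by (simp add: C_def)
  moreover have "\<forall>p. C p \<longrightarrow> length p < Suc (card E)"
    using fin by (metis C_def card_mono distinct_card less_Suc_eq_le)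
  ultimately obtain p where p: "C p" and max: "\<And>q. C q \<Longrightarrow> length q \<le> length p"
    using ex_has_greatest_nat[of C "[a]" length "Suc (card E)"] by auto
  have ne: "p \<noteq> []" using p by (auto simp: C_def)
  have last_hd: "b = hd p" if b: "r (last p) b" for b
  proof -
    have "b \<in> set p"
    proof (rule ccontr)
      assume "b \<notin> set p"
      then have "C (p @ [b])" using p b r[of "last p" b] ne
        by (auto simp: C_def successively_append_iff)
      then show False using max by fastforce
    qed
    then obtain u v where uv: "p = u @ b # v" by (meson split_list)
    show ?thesis
    proof (cases "u = []")
      case False
      have "r (last u) b" using p uv False by (auto simp: C_def successively_append_iff)
      then have "last u = last p" using b bwd by blast
      moreover have "last p \<in> set (b # v)" using uv by auto
      moreover have "last u \<in> set u" using False by simp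
      moreover have "set u \<inter> set (b # v) = {}" using p uv by (auto simp: C_def)
      ultimately show ?thesis by auto
    qed (simp add: uv)
  qed
  have hd_last: "b = last p" if b: "r b (hd p)" for b
  proof -
    have "b \<in> set p"
    proof (rule ccontr)
      assume "b \<notin> set p"
      then have "C (b # p)" using p b r[of b "hd p"] ne
        by (cases p) (auto simp: C_def)
      then show False using max by fastforce
    qed
    then obtain u v where uv: "p = (u @ [b]) @ v" by (metis append.assoc append_Cons append_Nil split_list)
    show ?thesis
    proof (cases "v = []")
      case False
      have "successively r ((u @ [b]) @ v)" using p uv by (simp add: C_def)
      then have "r b (hd v)"
        using False by (simp only: successively_append_iff[of r "u @ [b]" v]) simp
      then have "hd v = hd p" using b fwd by blast
      moreover have "hd p \<in> set (u @ [b])" using uv by (cases u) auto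
      moreover have "hd v \<in> set v" using False by simp
      ultimately show ?thesis using p uv by (auto simp: C_def)
    qed (simp add: uv)
  qed
  show ?thesis
    using that[of p] p ne last_hd hd_last unfolding C_def by blast
qed

lemma cas_iff_chain:
  assumes "p \<noteq> []"
  shows "pre_digraph.cas G u p v \<longleftrightarrow>
    tail G (hd p) = u \<and> head G (last p) = v \<and> successively (\<lambda>a b. head G a = tail G b) p"
  using assms
  by (induction p arbitrary: u rule: induct_list012) (auto simp: pre_digraph.cas.simps)


section \<open>Every edge lies on exactly one snake\<close>

locale crossing_network =
  fixes S :: "'a topology" and A :: "'a chart set" and N :: "('a, 'e) network"
  assumes simple_crossing: "simple_crossing_network S A N"
begin

definition turns :: "'e \<Rightarrow> 'e \<Rightarrow> bool" where
  "turns e e' \<longleftrightarrow> turn S N (e, e')"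

lemma oriented: "oriented_network S N"
  using simple_crossing by (simp add: simple_crossing_network_def)

lemma finite_edges: "finite (edges N)" and finite_interior: "finite (interior_vertices S N)"
  and edges_loops_disjoint: "edges N \<inter> loops N = {}"
  using oriented by (auto simp: oriented_network_def interior_vertices_def)

lemma vertex_cases:
  assumes "v \<in> vertices N"
  shows "v \<in> interior_vertices S N \<and> v \<notin> boundary_vertices S N
    \<or> v \<in> boundary_vertices S N \<and> v \<notin> interior_vertices S N"
  using assms by (auto simp: interior_vertices_def boundary_vertices_def)

lemma end_vertices:
  assumes "e \<in> edges N"
  shows "source N e \<in> vertices N" "target N e \<in> vertices N"
  using oriented assms by (auto simp: oriented_network_def)

lemma interior_in:
  assumes "v \<in> interior_vertices S N"
  shows "e \<in> edges N \<and> target N e = v \<longleftrightarrow> e = high_in N v \<or> e = under_in N v"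
    and "high_in N v \<noteq> under_in N v"
proof -
  have "{e \<in> edges N. target N e = v} = {high_in N v, under_in N v} \<and> high_in N v \<noteq> under_in N v"
    using simple_crossing assms by (simp add: simple_crossing_network_def)
  then show "e \<in> edges N \<and> target N e = v \<longleftrightarrow> e = high_in N v \<or> e = under_in N v"
    and "high_in N v \<noteq> under_in N v" by blast+
qed

lemma interior_out:
  assumes "v \<in> interior_vertices S N"
  shows "e \<in> edges N \<and> source N e = v \<longleftrightarrow> e = high_out N v \<or> e = under_out N v"
    and "high_out N v \<noteq> under_out N v"
proof -
  have "{e \<in> edges N. source N e = v} = {high_out N v, under_out N v} \<and> high_out N v \<noteq> under_out N v"
    using simple_crossing assms by (simp add: simple_crossing_network_def)
  then show "e \<in> edges N \<and> source N e = v \<longleftrightarrow> e = high_out N v \<or> e = under_out N v"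
    and "high_out N v \<noteq> under_out N v" by blast+
qed

lemma turnsD:
  assumes "turns e e'"
  shows "e \<in> edges N" "e' \<in> edges N" "target N e = source N e'"
    "target N e \<in> interior_vertices S N"
proof -
  show v: "target N e \<in> interior_vertices S N"
    using assms by (auto simp: turns_def turn_def Let_def)
  have "e = high_in N (target N e) \<or> e = under_in N (target N e)"
    and "e' = high_out N (target N e) \<or> e' = under_out N (target N e)"
    using assms by (auto simp: turns_def turn_def Let_def)
  then show "e \<in> edges N" "e' \<in> edges N" "target N e = source N e'"
    using interior_in(1)[OF v, of e] interior_out(1)[OF v, of e'] by auto
qed

lemma turns_functional:
  assumes "turns e f" "turns e g"
  shows "f = g"
  using assms interior_in(2)[OF turnsD(4)[OF assms(1)]]
  by (auto simp: turns_def turn_def Let_def)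

lemma turns_injective:
  assumes "turns e g" "turns f g"
  shows "e = f"
proof -
  have "target N e = target N f" using turnsD(3) assms by metis
  then show ?thesis
    using assms interior_out(2)[OF turnsD(4)[OF assms(1)]]
    by (auto simp: turns_def turn_def Let_def)
qed

lemma ex_turn_from:
  assumes "e \<in> edges N" "target N e \<in> interior_vertices S N"
  shows "\<exists>e'. turns e e'"
  using interior_in(1)[OF assms(2), of e] assms by (auto simp: turns_def turn_def Let_def)

lemma ex_turn_to:
  assumes "e \<in> edges N" "source N e \<in> interior_vertices S N"
  shows "\<exists>e'. turns e' e"
proof -
  let ?v = "source N e"
  have t: "target N (high_in N ?v) = ?v" "target N (under_in N ?v) = ?v"
    using interior_in(1)[OF assms(2)] by blast+
  have "e = high_out N ?v \<or> e = under_out N ?v"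
    using interior_out(1)[OF assms(2), of e] assms(1) by blast
  then have "turns (under_in N ?v) e \<or> turns (high_in N ?v) e"
    using t assms(2) by (auto simp: turns_def turn_def Let_def)
  then show ?thesis by blast
qed

text \<open>Both directions use that a vertex is either interior or on the boundary: turning is
  possible at each interior vertex, and only there.\<close>

lemma ends_at_boundary_iff:
  assumes "e \<in> edges N"
  shows "target N e \<in> boundary_vertices S N \<longleftrightarrow> (\<forall>f. \<not> turns e f)"
    and "source N e \<in> boundary_vertices S N \<longleftrightarrow> (\<forall>f. \<not> turns f e)"
  using assms vertex_cases end_vertices ex_turn_from ex_turn_to turnsD(3,4) by metis+

lemma turn_chain_iff:
  "successively turns p \<longleftrightarrow> (\<forall>a\<in>set (passages p). turn S N a)"
  unfolding turns_def[abs_def] by (rule successively_iff_passages)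

lemma turn_chain_joined:
  "successively turns p \<Longrightarrow> successively (\<lambda>a b. target N a = source N b) p"
  by (erule successively_mono) (simp_all add: turnsD(3))

lemma net_awalk_iff:
  assumes "p \<noteq> []"
  shows "pre_digraph.awalk (net_graph N) u p v \<longleftrightarrow>
    u \<in> vertices N \<and> set p \<subseteq> edges N \<and> source N (hd p) = u \<and> target N (last p) = v \<and>
    successively (\<lambda>a b. target N a = source N b) p"
  by (auto simp: pre_digraph.awalk_def cas_iff_chain[OF assms])
     (auto simp: net_graph_def)

text \<open>This and \<open>snake_cycle_iff\<close> reduce snakes to chains of the turning relation, without
  reference to vertices.\<close>

lemma snake_path_iff:
  "SnakePath p \<in> snakes S N \<longleftrightarrow> p \<noteq> [] \<and> set p \<subseteq> edges N \<and> successively turns p \<and>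
     (\<forall>f. \<not> turns f (hd p)) \<and> (\<forall>f. \<not> turns (last p) f)"
  (is "?L \<longleftrightarrow> ?R")
proof
  assume ?L
  then obtain u v where *: "p \<noteq> []" "u \<in> boundary_vertices S N" "v \<in> boundary_vertices S N"
    "pre_digraph.awalk (net_graph N) u p v" "successively turns p"
    by (auto simp: snakes_def turn_chain_iff)
  then have "set p \<subseteq> edges N" "source N (hd p) = u" "target N (last p) = v"
    by (auto simp: net_awalk_iff)
  moreover have "hd p \<in> edges N" "last p \<in> edges N" using * calculation by auto
  ultimately show ?R using * ends_at_boundary_iff by metis
next
  assume R: ?R
  then have "hd p \<in> edges N" "last p \<in> edges N" by auto
  then have b: "source N (hd p) \<in> boundary_vertices S N" "target N (last p) \<in> boundary_vertices S N"
    using R ends_at_boundary_iff by metis+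
  moreover have "pre_digraph.awalk (net_graph N) (source N (hd p)) p (target N (last p))"
    using R b turn_chain_joined[of p] by (simp add: net_awalk_iff boundary_vertices_def)
  ultimately show ?L using R unfolding snakes_def turn_chain_iff by blast
qed

text \<open>Representatives, with a chosen first edge, of the snake cycles other than loops without
  endpoints. Each turn joins its two edges, so these lists are closed walks (\<open>turning_cycle_iff\<close>).\<close>

definition turning_cycle :: "'e list \<Rightarrow> bool" where
  "turning_cycle p \<longleftrightarrow> p \<noteq> [] \<and> distinct p \<and> set p \<subseteq> edges N \<and>
     (\<forall>a\<in>set (cyclic_passages p). turn S N a)"

lemma turning_cycle_chain:
  assumes "p \<noteq> []"
  shows "(\<forall>a\<in>set (cyclic_passages p). turn S N a) \<longleftrightarrow> successively turns (p @ [hd p])"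
  by (simp add: turn_chain_iff cyclic_passages_eq_passages assms)

lemma turning_cycle_rotate: "turning_cycle p \<Longrightarrow> turning_cycle (rotate n p)"
  by (simp add: turning_cycle_def rotate_cyclic_passages)

lemma turning_cycle_iff:
  "turning_cycle p \<longleftrightarrow> (p \<noteq> [] \<and> distinct p \<and>
     (\<exists>u. pre_digraph.awalk (net_graph N) u p u) \<and> (\<forall>a\<in>set (cyclic_passages p). turn S N a))"
proof (cases "p = []")
  case False
  have "successively turns p \<and> turns (last p) (hd p) \<and> source N (hd p) \<in> vertices N"
    if "\<forall>a\<in>set (cyclic_passages p). turn S N a"
  proof -
    have "successively turns p \<and> turns (last p) (hd p)"
      using that turning_cycle_chain[OF False] False by (simp add: successively_append_iff)
    then show ?thesis using turnsD(2) end_vertices(1) by blast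
  qed
  then show ?thesis
    using False turn_chain_joined[of p] turnsD(3)[of "last p" "hd p"]
    by (auto simp: turning_cycle_def net_awalk_iff)
qed (simp add: turning_cycle_def)

lemma snake_cycle_iff:
  "SnakeCycle q \<in> snakes S N \<longleftrightarrow>
     (\<exists>p. q = rotations p \<and> turning_cycle p) \<or> (\<exists>l\<in>loops N. q = {[l]})"
  unfolding turning_cycle_iff by (auto simp: snakes_def)

lemma snake_edges_rotations: "snake_edges (SnakeCycle (rotations p)) = set p"
proof -
  have "rotate 0 p \<in> rotations p" unfolding rotations_def by blast
  then show ?thesis by (auto simp: rotations_def intro: bexI[of _ p])
qed

lemma ex_snake:
  assumes "e \<in> edges N"
  shows "\<exists>s\<in>snakes S N. e \<in> snake_edges s"
proof -
  obtain p where p: "p \<noteq> []" "e \<in> set p" "set p \<subseteq> edges N" "distinct p" "successively turns p"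
    and ends: "(\<forall>b. \<not> turns (last p) b) \<and> (\<forall>b. \<not> turns b (hd p)) \<or> turns (last p) (hd p)"
    by (rule maximal_chain[of "edges N" e turns, OF finite_edges assms])
       (use turnsD(1,2) turns_functional turns_injective in blast)+
  from ends show ?thesis
  proof
    assume "(\<forall>b. \<not> turns (last p) b) \<and> (\<forall>b. \<not> turns b (hd p))"
    then have "SnakePath p \<in> snakes S N" using p by (simp add: snake_path_iff)
    then show ?thesis using p(2) by (intro bexI[of _ "SnakePath p"]) auto
  next
    assume "turns (last p) (hd p)"
    then have "turning_cycle p"
      using p unfolding turning_cycle_def turning_cycle_chain[OF p(1)]
      by (simp add: successively_append_iff)
    then have "SnakeCycle (rotations p) \<in> snakes S N" by (auto simp: snake_cycle_iff)
    then show ?thesis using p(2) snake_edges_rotations by metis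
  qed
qed

text \<open>Both ends of a snake path are dead ends for turning. From \<open>e\<close>, the rest of the path is
  therefore forced forwards because turning is functional, and backwards because it is injective.\<close>

lemma snake_path_unique:
  assumes p: "SnakePath p \<in> snakes S N" "e \<in> set p"
    and q: "SnakePath q \<in> snakes S N" "e \<in> set q"
  shows "p = q"
proof -
  obtain a b where ab: "p = a @ e # b" using p(2) by (meson split_list)
  obtain c d where cd: "q = c @ e # d" using q(2) by (meson split_list)
  note P = p(1)[unfolded snake_path_iff] and Q = q(1)[unfolded snake_path_iff]
  have "b = d"
    using P Q turns_functional
    by (intro terminated_chain_unique[where r = turns and a = e])
       (auto simp: ab cd successively_append_iff)
  moreover have "rev a = rev c"
  proof (rule terminated_chain_unique[where r = "\<lambda>x y. turns y x" and a = e])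
    have "successively turns (a @ [e])" "successively turns (c @ [e])"
      using P Q by (auto simp: ab cd successively_append_iff)
    then show "successively (\<lambda>x y. turns y x) (e # rev a)" "successively (\<lambda>x y. turns y x) (e # rev c)"
      by (metis rev_append rev.simps append.simps successively_rev rev_rev_ident)+
    show "\<not> turns f (last (e # rev a))" "\<not> turns f (last (e # rev c))" for f
      using P Q by (auto simp: ab cd last_rev hd_append split: if_splits)
  qed (use turns_injective in blast)
  ultimately show ?thesis by (simp add: ab cd)
qed

lemma turning_cycle_turns:
  assumes "turning_cycle p" "e \<in> set p"
  shows "\<exists>f\<in>set p. turns e f"
proof -
  obtain n q where n: "rotate n p = e # q" using rotate_to_head[OF assms(2)] .
  have "turning_cycle (e # q)" using turning_cycle_rotate[OF assms(1), of n] n by simp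
  then have "successively turns (e # (q @ [e]))"
    using turning_cycle_chain[of "e # q"] by (simp add: turning_cycle_def)
  then have "turns e (hd (q @ [e]))" by (cases q) auto
  moreover have "hd (q @ [e]) \<in> set (rotate n p)" using n by (cases q) auto
  ultimately show ?thesis by auto
qed

lemma turning_cycle_closed:
  assumes "turning_cycle p" "e \<in> set p" "turns e f"
  shows "f \<in> set p"
  using turning_cycle_turns[OF assms(1,2)] assms(3) turns_functional by blast

text \<open>After rotating both cycles to start at \<open>e\<close>, each follows the forced continuation up to
  its first return to \<open>e\<close>.\<close>

lemma turning_cycle_unique:
  assumes p: "turning_cycle p" "e \<in> set p" and q: "turning_cycle q" "e \<in> set q"
  shows "rotations p = rotations q"
proof -
  obtain m a where m: "rotate m p = e # a" using rotate_to_head[OF p(2)] .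
  obtain n b where n: "rotate n q = e # b" using rotate_to_head[OF q(2)] .
  have "turning_cycle (e # a)" "turning_cycle (e # b)"
    using turning_cycle_rotate[OF p(1), of m] turning_cycle_rotate[OF q(1), of n] m n by simp_all
  then have "successively turns (e # a @ [e])" "e \<notin> set a"
    and "successively turns (e # b @ [e])" "e \<notin> set b"
    using turning_cycle_chain[of "e # a"] turning_cycle_chain[of "e # b"]
    by (auto simp: turning_cycle_def)
  then have "a = b" using cyclic_chain_unique[of turns e a b] turns_functional by blast
  then show ?thesis using m n rotations_rotate by metis
qed

text \<open>A cycle is closed under turning and so would contain the last edge of the path, from
  which no turn is possible.\<close>

lemma snake_path_not_on_cycle:
  assumes "SnakePath p \<in> snakes S N" "e \<in> set p" "turning_cycle q" "e \<in> set q"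
  shows False
proof -
  obtain a b where ab: "p = a @ e # b" using assms(2) by (meson split_list)
  have "successively turns (e # b)"
    using assms(1) by (auto simp: ab snake_path_iff successively_append_iff)
  then have "set (e # b) \<subseteq> set q"
    using chain_in_closed_set[of turns e b "set q"] assms(3,4) turning_cycle_closed by blast
  moreover have "last p \<in> set (e # b)" by (simp add: ab)
  ultimately have "\<exists>f. turns (last p) f" using turning_cycle_turns[OF assms(3)] by blast
  then show False using assms(1) by (simp add: snake_path_iff)
qed

lemma snake_through_edge_cases:
  assumes "s \<in> snakes S N" "e \<in> snake_edges s" "e \<in> edges N"
  obtains (path) p where "s = SnakePath p" "e \<in> set p"
  | (cycle) p where "s = SnakeCycle (rotations p)" "turning_cycle p" "e \<in> set p"
proof (cases s)
  case (SnakePath p)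
  then show ?thesis using path assms(2) by simp
next
  case (SnakeCycle q)
  have "\<not> (\<exists>l\<in>loops N. q = {[l]})"
    using assms(2,3) edges_loops_disjoint by (auto simp: SnakeCycle)
  then obtain p where "q = rotations p" "turning_cycle p"
    using assms(1) by (auto simp: SnakeCycle snake_cycle_iff)
  then show ?thesis using cycle SnakeCycle assms(2) snake_edges_rotations by metis
qed

lemma snake_unique:
  assumes "e \<in> edges N"
    and s: "s \<in> snakes S N" "e \<in> snake_edges s"
    and t: "t \<in> snakes S N" "e \<in> snake_edges t"
  shows "s = t"
  using s assms(1)
proof (cases rule: snake_through_edge_cases)
  case (path p)
  show ?thesis using t assms(1)
    by (cases rule: snake_through_edge_cases)
       (use path s(1) t(1) snake_path_unique snake_path_not_on_cycle in blast)+
next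
  case (cycle p)
  show ?thesis using t assms(1)
    by (cases rule: snake_through_edge_cases)
       (use cycle s(1) t(1) turning_cycle_unique snake_path_not_on_cycle in blast)+
qed

lemma snake_of_eq:
  assumes "e \<in> edges N" "s \<in> snakes S N" "e \<in> snake_edges s"
  shows "snake_of S N e = s"
  unfolding snake_of_def using assms snake_unique by (intro the_equality) blast+

lemma snake_of_snake:
  assumes "e \<in> edges N"
  shows "snake_of S N e \<in> snakes S N" "e \<in> snake_edges (snake_of S N e)"
  using ex_snake[OF assms] snake_of_eq[OF assms] by metis+

lemma snake_of_turn:
  assumes "turns e f"
  shows "snake_of S N e = snake_of S N f"
proof -
  let ?s = "snake_of S N e"
  have e: "e \<in> edges N" "f \<in> edges N" using assms turnsD by blast+
  have "f \<in> snake_edges ?s" using snake_of_snake[OF e(1)] e(1)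
  proof (cases rule: snake_through_edge_cases)
    case (path p)
    then obtain a b where ab: "p = a @ e # b" by (meson split_list)
    have p: "SnakePath p \<in> snakes S N" using snake_of_snake(1)[OF e(1)] path by simp
    show ?thesis
    proof (cases b)
      case Nil
      then show ?thesis using p assms by (auto simp: snake_path_iff ab)
    next
      case (Cons g b')
      then have "turns e g" using p by (auto simp: snake_path_iff ab successively_append_iff)
      then have "g = f" using assms turns_functional by blast
      then show ?thesis by (simp add: path ab Cons)
    qed
  next
    case (cycle p)
    then show ?thesis using turning_cycle_closed assms snake_edges_rotations by metis
  qed
  then show ?thesis using snake_of_eq[OF e(2)] snake_of_snake(1)[OF e(1)] by metis
qed

text \<open>Every edge of a snake cycle has a turn both before and after it, so both its end vertices
  are interior.\<close>

lemma snake_of_terminal: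
  assumes "e \<in> edges N" "source N e \<in> boundary_vertices S N \<or> target N e \<in> boundary_vertices S N"
  shows "snake_of S N e \<in> terminals S N"
  using snake_of_snake[OF assms(1)] assms(1)
proof (cases rule: snake_through_edge_cases)
  case (path p)
  then show ?thesis using snake_of_snake[OF assms(1)] by (auto simp: terminals_def)
next
  case (cycle p)
  have "\<exists>f. turns e f" using turning_cycle_turns[OF cycle(2,3)] by blast
  moreover have "\<exists>f. turns f e"
  proof -
    obtain n a where n: "rotate n p = e # a" using rotate_to_head[OF cycle(3)] .
    have "turning_cycle (e # a)" using turning_cycle_rotate[OF cycle(2), of n] n by simp
    then have "successively turns ((e # a) @ [e])"
      using turning_cycle_chain[of "e # a"] by (simp add: turning_cycle_def)
    then show ?thesis by (simp only: successively_append_iff) auto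
  qed
  ultimately show ?thesis using assms ends_at_boundary_iff by blast
qed


section \<open>Highway walks trace walks in the graph of snakes\<close>

definition straight_vertices :: "('e \<times> 'e) list \<Rightarrow> 'a list" where
  "straight_vertices ps = map (\<lambda>a. target N (fst a)) (filter (high_passage S N) ps)"

text \<open>A boundary vertex has degree at most one, hence no walk passes through it. At an interior
  vertex there are four passages: straight on the highway, straight on the underway, and two turns.\<close>

lemma highway_passage_cases:
  assumes "e \<in> edges N" "f \<in> edges N" "target N e = source N f" "\<not> under_passage S N (e, f)"
  shows "high_passage S N (e, f) \<or> turns e f"
proof -
  let ?v = "target N e"
  have "?v \<notin> boundary_vertices S N"
  proof
    assume "?v \<in> boundary_vertices S N"
    then have "card {e \<in> edges N. source N e = ?v} + card {e \<in> edges N. target N e = ?v} \<le> 1"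
      using oriented by (simp add: oriented_network_def)
    moreover have "card {e \<in> edges N. source N e = ?v} > 0" "card {e \<in> edges N. target N e = ?v} > 0"
      using assms finite_edges by (auto simp: card_gt_0_iff)
    ultimately show False by linarith
  qed
  then have v: "?v \<in> interior_vertices S N" using vertex_cases end_vertices assms(1) by blast
  have "e = high_in N ?v \<or> e = under_in N ?v" "f = high_out N ?v \<or> f = under_out N ?v"
    using interior_in(1)[OF v, of e] interior_out(1)[OF v, of f] assms by auto
  then show ?thesis
    using v assms(4) by (auto simp: high_passage_def under_passage_def turns_def turn_def Let_def)
qed

text \<open>A turn does not change the snake, and a straight passage at \<open>v\<close> is the arc \<open>v\<close> of the
  graph of snakes.\<close>

lemma highway_walk_snake_walk:
  assumes "p \<noteq> []" "set p \<subseteq> edges N" "successively (\<lambda>a b. target N a = source N b) p"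
    and "\<forall>a\<in>set (passages p). \<not> under_passage S N a"
  shows "pre_digraph.awalk (snake_graph S N) (snake_of S N (hd p)) (straight_vertices (passages p))
           (snake_of S N (last p))"
  using assms
proof (induction p rule: induct_list012)
  case (2 e)
  then show ?case
    by (simp add: pre_digraph.awalk_def pre_digraph.cas.simps straight_vertices_def passages_def
        snake_graph_def snake_of_snake)
next
  case (3 e f p)
  let ?G = "snake_graph S N"
  have IH: "pre_digraph.awalk ?G (snake_of S N f) (straight_vertices (passages (f # p)))
      (snake_of S N (last (f # p)))"
    using 3 by (simp add: passages_Cons)
  have "high_passage S N (e, f) \<or> turns e f"
    using 3 by (intro highway_passage_cases) (auto simp: passages_Cons)
  then show ?case
  proof (cases "high_passage S N (e, f)")
    case True
    then have v: "target N e \<in> interior_vertices S N"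
      "e = high_in N (target N e)" "f = high_out N (target N e)"
      by (auto simp: high_passage_def Let_def)
    have "straight_vertices (passages (e # f # p)) = target N e # straight_vertices (passages (f # p))"
      using True by (simp add: straight_vertices_def passages_Cons)
    moreover have "tail ?G (target N e) = snake_of S N e" "head ?G (target N e) = snake_of S N f"
      using v(2,3) by (simp_all add: snake_graph_def)
    moreover have "target N e \<in> arcs ?G" "snake_of S N e \<in> verts ?G"
      using v(1) 3 snake_of_snake(1) by (simp_all add: snake_graph_def)
    ultimately show ?thesis
      using IH by (simp add: pre_digraph.awalk_def pre_digraph.cas.simps)
  next
    case False
    then have "turns e f" using \<open>high_passage S N (e, f) \<or> turns e f\<close> by blast
    then show ?thesis
      using IH False by (simp add: snake_of_turn straight_vertices_def passages_Cons)
  qed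
qed simp

lemma highway_path_test_walk:
  assumes "highway_path S N u p v" "u \<in> boundary_vertices S N" "v \<in> boundary_vertices S N"
    "p \<noteq> []"
  shows "straight_vertices (passages p) \<in> test_walks S N"
proof -
  have p: "set p \<subseteq> edges N" "source N (hd p) = u" "target N (last p) = v"
    "successively (\<lambda>a b. target N a = source N b) p"
    and h: "\<forall>a\<in>set (passages p). \<not> under_passage S N a"
    using assms by (auto simp: highway_path_def net_awalk_iff)
  have "hd p \<in> edges N" "last p \<in> edges N" using p(1) assms(4) by auto
  then have "snake_of S N (hd p) \<in> terminals S N" "snake_of S N (last p) \<in> terminals S N"
    using p assms(2,3) by (auto intro: snake_of_terminal)
  then show ?thesis
    using highway_walk_snake_walk[OF assms(4) p(1,4) h] unfolding test_walks_def by blast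
qed

lemma highway_cycle_test_walk:
  assumes "p \<noteq> []" "pre_digraph.awalk (net_graph N) u p u"
    and "\<forall>a\<in>set (cyclic_passages p). \<not> under_passage S N a"
  shows "straight_vertices (cyclic_passages p) \<in> test_walks S N"
proof -
  have "set p \<subseteq> edges N" "successively (\<lambda>a b. target N a = source N b) (p @ [hd p])"
    using assms(1,2) by (auto simp: net_awalk_iff successively_append_iff)
  moreover have "hd p \<in> edges N" using assms(1) calculation(1) by auto
  ultimately have "pre_digraph.awalk (snake_graph S N) (snake_of S N (hd p))
      (straight_vertices (cyclic_passages p)) (snake_of S N (hd p))"
    using highway_walk_snake_walk[of "p @ [hd p]"] assms cyclic_passages_eq_passages[OF assms(1)]
    by simp
  then show ?thesis unfolding test_walks_def by blast
qed


section \<open>The torus action\<close>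

lemma arc_inner_arc_vec:
  assumes "v \<in> interior_vertices S N"
  shows "arc_inner S N (arc_vec v) z = z v"
  using assms finite_interior
  by (simp add: arc_inner_def arc_vec_def if_distrib[of "\<lambda>c. c * _"] cong: if_cong)

lemma arc_inner_walk_vec:
  assumes "set p \<subseteq> interior_vertices S N"
  shows "arc_inner S N z (walk_vec p) = (\<Sum>v\<leftarrow>p. z v)"
  using assms
proof (induction p)
  case (Cons v p)
  have "arc_inner S N z (walk_vec (v # p)) = arc_inner S N (arc_vec v) z + arc_inner S N z (walk_vec p)"
    by (simp add: arc_inner_def walk_vec_def distrib_left sum.distrib mult.commute)
  then show ?case using Cons by (simp add: arc_inner_arc_vec)
qed (simp add: arc_inner_def walk_vec_def)

lemma torus_act_passage_weight_factor:
  fixes \<tau> :: "nat \<Rightarrow> 'k::field"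
  assumes "\<forall>i<k. \<tau> i \<noteq> 0"
  shows "passage_weight S N (torus_act S N k w \<tau> x) ps =
    (\<Prod>i<k. \<tau> i powi (\<Sum>v\<leftarrow>straight_vertices ps. w i v)) * passage_weight S N x ps"
proof (induction ps)
  case (Cons a ps)
  show ?case
  proof (cases "high_passage S N a")
    case True
    let ?v = "target N (fst a)"
    have v: "?v \<in> interior_vertices S N"
      using True by (auto simp: high_passage_def Let_def split_beta)
    have "(\<Prod>i<k. \<tau> i powi (\<Sum>v\<leftarrow>straight_vertices (a # ps). w i v)) =
        (\<Prod>i<k. \<tau> i powi w i ?v) * (\<Prod>i<k. \<tau> i powi (\<Sum>v\<leftarrow>straight_vertices ps. w i v))"
      using True assms
      by (simp add: straight_vertices_def power_int_add flip: prod.distrib)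
    then show ?thesis
      using True v Cons by (simp add: passage_weight_def torus_act_def arc_inner_arc_vec)
  next
    case False
    then show ?thesis using Cons by (simp add: passage_weight_def straight_vertices_def)
  qed
qed (simp add: passage_weight_def straight_vertices_def)

lemma torus_act_passage_weight:
  fixes \<tau> :: "nat \<Rightarrow> 'k::field"
  assumes "\<forall>i<k. \<tau> i \<noteq> 0" and "\<forall>i<k. w i \<in> W_module S N"
    and "straight_vertices ps \<in> test_walks S N"
  shows "passage_weight S N (torus_act S N k w \<tau> x) ps = passage_weight S N x ps"
proof -
  have "set (straight_vertices ps) \<subseteq> interior_vertices S N"
    by (auto simp: straight_vertices_def high_passage_def Let_def split_beta)
  \<comment> \<open>the exponent of \<open>\<tau> i\<close> is the inner product of \<open>w i\<close> with the vector of a test walk\<close>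
  then have "(\<Sum>v\<leftarrow>straight_vertices ps. w i v) = 0" if "i < k" for i
    using assms(2,3) that arc_inner_walk_vec[of "straight_vertices ps" "w i"]
    by (simp add: W_module_def)
  then show ?thesis using torus_act_passage_weight_factor[OF assms(1)] by simp
qed

lemma torus_act_path_weight:
  fixes \<tau> :: "nat \<Rightarrow> 'k::field"
  assumes "\<forall>i<k. \<tau> i \<noteq> 0" and "\<forall>i<k. w i \<in> W_module S N"
    and "u \<in> boundary_vertices S N" "v \<in> boundary_vertices S N" "highway_path S N u p v"
  shows "path_weight S N (torus_act S N k w \<tau> x) p = path_weight S N x p"
proof (cases "p = []")
  case True
  then show ?thesis by (simp add: path_weight_def passages_def passage_weight_def)
next
  case False
  then show ?thesis
    unfolding path_weight_def
    using torus_act_passage_weight[where k = k] highway_path_test_walk assms by metis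
qed

text \<open>The weight is defined through an arbitrary representative of the cycle; rotating the
  representative only permutes the factors.\<close>

lemma cycle_weight_eq:
  "cycle_weight S N x (rotations p) = passage_weight S N x (cyclic_passages p)"
proof -
  have "rotate 0 p \<in> rotations p" unfolding rotations_def by blast
  then have "(SOME r. r \<in> rotations p) \<in> rotations p" by (rule someI)
  then obtain n where n: "(SOME r. r \<in> rotations p) = rotate n p" by (auto simp: rotations_def)
  have "prod_list (rotate n l) = prod_list l" for l :: "'c::comm_monoid_mult list"
  proof (induction n)
    case (Suc n)
    have "prod_list (rotate1 m) = prod_list m" for m :: "'c list"
      by (cases m) (simp_all add: mult.commute)
    then show ?case using Suc by simp
  qed simp
  then show ?thesis
    by (simp add: cycle_weight_def n rotate_cyclic_passages passage_weight_def flip: rotate_map)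
qed

text \<open>Walks around a loop without endpoints meet no vertex, so their weight is an empty
  product; all other cycles give closed test walks.\<close>

lemma torus_act_cycle_weight:
  fixes \<tau> :: "nat \<Rightarrow> 'k::field"
  assumes "\<forall>i<k. \<tau> i \<noteq> 0" and "\<forall>i<k. w i \<in> W_module S N"
    and "q \<in> highway_cycles S N"
  shows "cycle_weight S N (torus_act S N k w \<tau> x) q = cycle_weight S N x q"
proof -
  obtain p where q: "q = rotations p" and p: "p \<in> closed_walks N"
    and h: "\<forall>a\<in>set (cyclic_passages p). \<not> under_passage S N a"
    using assms(3) by (auto simp: highway_cycles_def)
  from p consider u where "p \<noteq> []" "pre_digraph.awalk (net_graph N) u p u"
    | m l where "p = replicate m l" "l \<in> loops N"
    by (auto simp: closed_walks_def)
  then show ?thesis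
  proof cases
    case 1
    then have "straight_vertices (cyclic_passages p) \<in> test_walks S N"
      using h highway_cycle_test_walk by blast
    then show ?thesis
      unfolding q cycle_weight_eq
      using torus_act_passage_weight[where k = k] assms(1,2) by metis
  next
    case 2
    have "\<forall>l\<in>loops N. curve N l ` {0..1} \<inter> (vertices N \<union> surface_boundary S) = {}"
      using oriented by (simp add: oriented_network_def)
    then have "curve N l ` {0..1} \<inter> (vertices N \<union> surface_boundary S) = {}"
      using 2(2) by (rule bspec)
    moreover have "target N l \<in> curve N l ` {0..1}" by (auto simp: net_graph_def)
    ultimately have "target N l \<notin> interior_vertices S N" by (auto simp: interior_vertices_def)
    then have "\<not> high_passage S N a" if "a \<in> set (cyclic_passages p)" for a
      using that 2(1)
      by (auto simp: cyclic_passages_def high_passage_def Let_def dest!: set_zip_leftD)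
    then show ?thesis
      by (simp add: q cycle_weight_eq passage_weight_def cong: map_cong)
  qed
qed

end

text \<open>Convergence depends only on the finite partial sums, so this holds for every topology,
  including those in which the sums diverge.\<close>

lemma field_sum_cong:
  assumes "\<And>i. i \<in> I \<Longrightarrow> f i = g i"
  shows "field_sum T f I = field_sum T g I"
proof -
  have "\<forall>\<^sub>F F in finite_subsets_at_top I. sum f F = sum g F"
    unfolding eventually_finite_subsets_at_top
    using assms by (intro exI[of _ "{}"]) (auto intro!: sum.cong)
  then have "limitin T (sum f) s (finite_subsets_at_top I) \<longleftrightarrow>
      limitin T (sum g) s (finite_subsets_at_top I)" for s
    by (metis (mono_tags, lifting) eventually_mono limitin_transform_eventually)
  then show ?thesis by (simp add: field_sum_def)
qed

lemma units_group_group: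
  assumes "is_subfield K"
  shows "group (units_group K)"
proof (rule groupI)
  fix a assume "a \<in> carrier (units_group K)"
  then show "\<exists>b\<in>carrier (units_group K). b \<otimes>\<^bsub>units_group K\<^esub> a = \<one>\<^bsub>units_group K\<^esub>"
    using assms by (intro bexI[of _ "inverse a"]) (auto simp: units_group_def is_subfield_def)
qed (use assms in \<open>auto simp: units_group_def is_subfield_def\<close>)

lemma torus_group: "is_subfield K \<Longrightarrow> group (torus K k)"
  by (simp add: torus_def units_group_group)

lemma torus_nonzero: "\<tau> \<in> carrier (torus K k) \<Longrightarrow> i < k \<Longrightarrow> \<tau> i \<noteq> 0"
  by (auto simp: torus_def units_group_def dest: PiE_mem)

lemma torus_act_weightings: "torus_act S N k w \<tau> x \<in> weightings S N"
  by (simp add: torus_act_def weightings_def)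

lemma torus_act_one:
  assumes "x \<in> weightings S N"
  shows "torus_act S N k w \<one>\<^bsub>torus K k\<^esub> x = x"
  using assms
  by (auto simp: torus_act_def torus_def units_group_def weightings_def fun_eq_iff
      PiE_def extensional_def)

lemma torus_act_mult:
  "torus_act S N k w (\<sigma> \<otimes>\<^bsub>torus K k\<^esub> \<tau>) x = torus_act S N k w \<sigma> (torus_act S N k w \<tau> x)"
  by (auto simp: torus_act_def torus_def units_group_def fun_eq_iff power_int_mult_distrib
      prod.distrib mult.assoc)

lemma torus_group_action:
  assumes "is_subfield K"
  shows "group_action (torus K k) (weightings S N)
           (\<lambda>\<tau>. \<lambda>x\<in>weightings S N. torus_act S N k w \<tau> x)"
proof -
  interpret torus: group "torus K k" using torus_group[OF assms] .
  let ?E = "weightings S N"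
  have bij: "bij_betw (\<lambda>x\<in>?E. torus_act S N k w \<tau> x) ?E ?E" if "\<tau> \<in> carrier (torus K k)" for \<tau>
  proof (rule bij_betwI)
    let ?i = "inv\<^bsub>torus K k\<^esub> \<tau>"
    show "torus_act S N k w ?i \<in> ?E \<rightarrow> ?E" "(\<lambda>x\<in>?E. torus_act S N k w \<tau> x) \<in> ?E \<rightarrow> ?E"
      by (auto simp: torus_act_weightings)
    show "torus_act S N k w ?i ((\<lambda>x\<in>?E. torus_act S N k w \<tau> x) x) = x"
      "(\<lambda>x\<in>?E. torus_act S N k w \<tau> x) (torus_act S N k w ?i x) = x" if "x \<in> ?E" for x
      using that \<open>\<tau> \<in> carrier (torus K k)\<close>
      by (simp_all add: torus_act_weightings torus_act_one flip: torus_act_mult[where K = K])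
  qed
  have "(\<lambda>\<tau>. \<lambda>x\<in>?E. torus_act S N k w \<tau> x) \<in> hom (torus K k) (BijGroup ?E)"
    using bij
    by (intro homI) (auto simp: BijGroup_def Bij_def compose_def torus_act_mult
        torus_act_weightings fun_eq_iff)
  then show ?thesis
    unfolding group_action_def group_hom_def group_hom_axioms_def
    using torus.is_group group_BijGroup by blast
qed

theorem proposition3p3:
  fixes S :: "'a topology" and A :: "'a chart set" and N :: "('a, 'e) network"
    and K :: "'k::field set" and T :: "'k topology"
    and k :: nat and w :: "nat \<Rightarrow> 'a \<Rightarrow> int"
  assumes "oriented_surface S A"
    and "simple_crossing_network S A N"
    and "is_subfield K"
    and "Z_basis (W_module S N) k w"
  shows "group_action (torus K k) (weightings S N :: ('a \<Rightarrow> 'k) set)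
           (\<lambda>\<tau>. \<lambda>x\<in>weightings S N. torus_act S N k w \<tau> x)
       \<and> (\<forall>\<tau>\<in>carrier (torus K k). \<forall>x\<in>weightings S N.
            (\<forall>u\<in>boundary_vertices S N. \<forall>v\<in>boundary_vertices S N. \<forall>c\<in>path_classes S u v.
               boundary_measurement T S N (torus_act S N k w \<tau> x) u v c =
               boundary_measurement T S N x u v c) \<and>
            (\<forall>c\<in>carrier (homology_group 1 S) - {\<one>\<^bsub>homology_group 1 S\<^esub>}.
               cycle_measurement T S N (torus_act S N k w \<tau> x) c =
               cycle_measurement T S N x c))"
proof (intro conjI ballI)
  interpret crossing_network S A N using assms(2) by unfold_locales
  show "group_action (torus K k) (weightings S N :: ('a \<Rightarrow> 'k) set)
      (\<lambda>\<tau>. \<lambda>x\<in>weightings S N. torus_act S N k w \<tau> x)"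
    using assms(3) by (rule torus_group_action)
  fix \<tau> :: "nat \<Rightarrow> 'k" and x :: "'a \<Rightarrow> 'k"
  assume "\<tau> \<in> carrier (torus K k)"
  then have nz: "\<forall>i<k. \<tau> i \<noteq> 0" by (simp add: torus_nonzero)
  have W: "\<forall>i<k. w i \<in> W_module S N" using assms(4) by (simp add: Z_basis_def)
  show "boundary_measurement T S N (torus_act S N k w \<tau> x) u v c = boundary_measurement T S N x u v c"
    if "u \<in> boundary_vertices S N" "v \<in> boundary_vertices S N" for u v c
    unfolding boundary_measurement_def
    by (rule field_sum_cong) (use torus_act_path_weight[OF nz W that] in blast)
  have "field_sum T (\<lambda>q. cycle_weight S N (torus_act S N k w \<tau> x) q / of_nat (cycle_mult q))
        {q \<in> highway_cycles S N. cycle_class S N q = c} =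
      field_sum T (\<lambda>q. cycle_weight S N x q / of_nat (cycle_mult q))
        {q \<in> highway_cycles S N. cycle_class S N q = c}" for c
    by (rule field_sum_cong) (use torus_act_cycle_weight[OF nz W] in auto)
  then show "cycle_measurement T S N (torus_act S N k w \<tau> x) c = cycle_measurement T S N x c" for c
    by (simp only: cycle_measurement_def Let_def)
qed

end
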